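(* A formula $F$ is valid if and only if it is uniformly valid, i.e.: $F^*$ is computable for every $F$-admissible interpretation $^*$ if and only if there exists a single HPM $\mathcal H$ that wins $F^*$ for every $F$-admissible interpretation $^*$.
   Context: Games. Constants are $0,1,2,\ldots$; variables are $v_0,v_1,v_2,\ldots$; terms are variables and constants. A valuation is a function $e$ from variables to constants, extended by $e(c)=c$. Players are $\top$ (machine) and $\bot$ (environment), $\neg\top=\bot,\neg\bot=\top$. Moves are finite strings over a fixed alphabet containing a special symbol $\spadesuit$; a labmove is a move prefixed by a player; a run is a finite or infinite sequence of labmoves; $\langle\rangle$ is the empty run; $\neg\Gamma$ swaps all labels of $\Gamma$. A game $A$ assigns to each valuation $e$ a set $\mathbf{Lr}^A_e$ of (legal) runs, such that a run is in it iff all its nonempty finite initial segments are, and no run containing $\spadesuit$ is in it, and a function $\mathbf{Wn}^A_e$ from runs to players such that if $\Gamma$ is illegal and the last labmove of its shortest illegal initial segment is $\wp$-labeled then $\mathbf{Wn}^A_e\langle\Gamma\rangle=\neg\wp$. $A$ depends on $x$ if two valuations differing only on $x$ yield different $\mathbf{Lr}$ or $\mathbf{Wn}$. An elementary game (predicate) is one whose only legal run is $\langle\rangle$; $\top,\bot$ also denote the constant elementary games won by $\top$, resp. $\bot$. Operations. $A[x_1/t_1,\ldots,x_n/t_n]$ behaves under $e$ as $A$ under the valuation $e'$ agreeing with $e$ except $e'(x_i)=e(t_i)$; if $A$ is written $A(x_1,\ldots,x_n)$, $A(t_1,\ldots,t_n)$ denotes this. $\neg A$: legal runs $\{\Gamma:\neg\Gamma\in\mathbf{Lr}^A_e\}$,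 $\mathbf{Wn}^{\neg A}_e\langle\Gamma\rangle=\neg\mathbf{Wn}^A_e\langle\neg\Gamma\rangle$. With $\Gamma^{\gamma}$ the result of keeping only labmoves $\wp\gamma\alpha$ and changing them to $\wp\alpha$: $A_1\wedge\cdots\wedge A_n$ has as legal runs those $\Gamma$ whose every move has a prefix $i.$ ($1\le i\le n$) with each $\Gamma^{i.}\in\mathbf{Lr}^{A_i}_e$, won by $\top$ iff each $\Gamma^{i.}$ is won by $\top$ in $A_i$. $A_1\vee\cdots\vee A_n=\neg(\neg A_1\wedge\cdots\wedge\neg A_n)$, $A\rightarrow B=\neg A\vee B$. $A_1\sqcap\cdots\sqcap A_n$: legal runs are $\langle\rangle$ and $\langle\bot i,\Delta\rangle$ with $\Delta\in\mathbf{Lr}^{A_i}_e$; $\bot$ wins exactly the runs $\langle\bot i,\Delta\rangle$ with $\Delta$ won by $\bot$ in $A_i$. $\sqcap xA(x)$: the same with initial $\bot$-move any constant $c$ and $A(c)$ in place of $A_i$. $\sqcup$ and $\sqcup x$ are the duals ($\neg\sqcap\neg$). $\forall xA(x)$ has the legal runs of $A(x)$, and $\top$ wins $\Gamma$ iff $\top$ wins $\Gamma$ in $A(c)$ for every constant $c$; $\exists=\neg\forall\neg$. Machines. An HPM is a Turing machine with a work tape, a read-only valuation tape holding a valuation $e$, and a read-only run tape showing the current position; it makes moves (labeled $\top$, at most one per step) by entering move states, while the environment may append any finite number of $\bot$-labeled moves between steps. An HPM wins $A$ iff for every valuation $e$ and every possible computation (over all environment behaviors) with $e$ on the valuation tape,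 the generated run $\Gamma$ satisfies $\mathbf{Wn}^A_e\langle\Gamma\rangle=\top$; $A$ is computable iff some HPM wins it. Formulas are built from nonlogical atoms $p(t_1,\ldots,t_n)$ and logical atoms $\top,\bot$ using $\neg,\wedge,\vee,\rightarrow,\sqcap,\sqcup$ and quantifiers $\forall,\exists,\sqcap x,\sqcup x$. An interpretation $^*$ assigns to each $n$-ary predicate letter $p$ an elementary game $p^*=A(x_1,\ldots,x_n)$ with attached tuple of pairwise distinct variables, extended by $(p(t_1,\ldots,t_n))^*=A(t_1,\ldots,t_n)$ and commuting with all connectives and quantifiers. $^*$ is $F$-admissible iff no $p^*=A(x_1,\ldots,x_n)$ depends on a variable occurring in $F$ but not among $x_1,\ldots,x_n$. *)

theory Defs
  imports "HOL-Library.Infinite_Set"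
begin

section \<open>Valuations, players, moves, runs\<close>

type_synonym const = nat
type_synonym var = nat

text \<open>The variable \<open>v\<^sub>i\<close> is represented by its index \<open>i\<close>.\<close>

datatype tm = Var var | Const const

type_synonym valuation = "var \<Rightarrow> const"

fun tm_val :: "valuation \<Rightarrow> tm \<Rightarrow> const" where
  "tm_val e (Var x) = e x"
| "tm_val e (Const c) = c"

text \<open>\<open>Machine\<close> is the player \<open>\<top>\<close> and \<open>Environment\<close> is the player \<open>\<bottom>\<close>.\<close>

datatype player = Machine | Environment

fun opp :: "player \<Rightarrow> player" where
  "opp Machine = Environment"
| "opp Environment = Machine"

datatype symbol = Key char | Spade

type_synonym move = "symbol list"
type_synonym labmove = "player \<times> move"

datatype run = Fin "labmove list" | Inf "nat \<Rightarrow> labmove"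

fun labmoves :: "run \<Rightarrow> labmove set" where
  "labmoves (Fin xs) = set xs"
| "labmoves (Inf f) = range f"

fun neg_labmove :: "labmove \<Rightarrow> labmove" where
  "neg_labmove (p, \<alpha>) = (opp p, \<alpha>)"

fun neg_run :: "run \<Rightarrow> run" where
  "neg_run (Fin xs) = Fin (map neg_labmove xs)"
| "neg_run (Inf f) = Inf (\<lambda>n. neg_labmove (f n))"

fun cons_run :: "labmove \<Rightarrow> run \<Rightarrow> run" where
  "cons_run l (Fin xs) = Fin (l # xs)"
| "cons_run l (Inf f) = Inf (case_nat l f)"

text \<open>The first \<open>n\<close> labmoves of a run (the whole run if it has fewer than \<open>n\<close>).\<close>

fun init_seg :: "nat \<Rightarrow> run \<Rightarrow> labmove list" where
  "init_seg n (Fin xs) = take n xs"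
| "init_seg n (Inf f) = map f [0..<n]"

fun strip :: "move \<Rightarrow> labmove \<Rightarrow> labmove option" where
  "strip \<gamma> (p, \<alpha>) =
     (if take (length \<gamma>) \<alpha> = \<gamma> then Some (p, drop (length \<gamma>) \<alpha>) else None)"

text \<open>The run \<open>\<Gamma>\<^sup>\<gamma>\<close>.\<close>

fun subrun :: "move \<Rightarrow> run \<Rightarrow> run" where
  "subrun \<gamma> (Fin xs) = Fin (List.map_filter (strip \<gamma>) xs)"
| "subrun \<gamma> (Inf f) =
     (let I = {n. strip \<gamma> (f n) \<noteq> None} in
      if finite I then Fin (map (\<lambda>n. the (strip \<gamma> (f n))) (sorted_list_of_set I))
      else Inf (\<lambda>k. the (strip \<gamma> (f (enumerate I k)))))"

text \<open>Decimal notation; the ASCII code of the digit \<open>0\<close> is 48.\<close>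

fun decimal :: "nat \<Rightarrow> move" where
  "decimal n = (if n < 10 then [Key (char_of (48 + n))]
                else decimal (n div 10) @ [Key (char_of (48 + n mod 10))])"

declare decimal.simps [simp del]

definition component :: "nat \<Rightarrow> move" where
  "component i = decimal i @ [Key (CHR ''.'')]"


section \<open>Games\<close>

record game =
  Lr :: "valuation \<Rightarrow> run set"
  Wn :: "valuation \<Rightarrow> run \<Rightarrow> player"

text \<open>The label of the last labmove of the shortest illegal initial segment of an illegal run.\<close>

definition offender :: "run set \<Rightarrow> run \<Rightarrow> player" where
  "offender L \<Gamma> = fst (last (init_seg (LEAST n. Fin (init_seg n \<Gamma>) \<notin> L) \<Gamma>))"

definition is_game :: "game \<Rightarrow> bool" where
  "is_game A \<longleftrightarrow> (\<forall>e.
     (\<forall>\<Gamma>. \<Gamma> \<in> Lr A e \<longleftrightarrow>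
        (\<forall>n. init_seg n \<Gamma> \<noteq> [] \<longrightarrow> Fin (init_seg n \<Gamma>) \<in> Lr A e)) \<and>
     (\<forall>\<Gamma> \<in> Lr A e. \<forall>(p, \<alpha>) \<in> labmoves \<Gamma>. Spade \<notin> set \<alpha>) \<and>
     (\<forall>\<Gamma>. \<Gamma> \<notin> Lr A e \<longrightarrow> Wn A e \<Gamma> = opp (offender (Lr A e) \<Gamma>)))"

definition depends_on :: "game \<Rightarrow> var \<Rightarrow> bool" where
  "depends_on A x \<longleftrightarrow>
     (\<exists>e e'. (\<forall>y. y \<noteq> x \<longrightarrow> e y = e' y) \<and> (Lr A e \<noteq> Lr A e' \<or> Wn A e \<noteq> Wn A e'))"

definition elementary :: "game \<Rightarrow> bool" where
  "elementary A \<longleftrightarrow> is_game A \<and> (\<forall>e. Lr A e = {Fin []})"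

text \<open>
  The winner clauses of the game operations describe legal runs only: on an illegal run the winner
  is dictated by the definition of a game. \<open>mk_game L W\<close> has the legal runs \<open>L\<close>, the winner
  \<open>W\<close> on legal runs, and the forced winner on illegal ones.
\<close>

definition mk_game :: "(valuation \<Rightarrow> run set) \<Rightarrow> (valuation \<Rightarrow> run \<Rightarrow> player) \<Rightarrow> game" where
  "mk_game L W = \<lparr> Lr = L,
     Wn = (\<lambda>e \<Gamma>. if \<Gamma> \<in> L e then W e \<Gamma> else opp (offender (L e) \<Gamma>)) \<rparr>"


section \<open>Operations on games\<close>

definition g_top :: game where
  "g_top = mk_game (\<lambda>e. {Fin []}) (\<lambda>e \<Gamma>. Machine)"

definition g_bot :: game where
  "g_bot = mk_game (\<lambda>e. {Fin []}) (\<lambda>e \<Gamma>. Environment)"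

definition subst_val :: "valuation \<Rightarrow> var list \<Rightarrow> tm list \<Rightarrow> valuation" where
  "subst_val e xs ts =
     (\<lambda>y. case map_of (zip xs ts) y of None \<Rightarrow> e y | Some t \<Rightarrow> tm_val e t)"

definition g_subst :: "game \<Rightarrow> var list \<Rightarrow> tm list \<Rightarrow> game" where
  "g_subst A xs ts =
     \<lparr> Lr = (\<lambda>e. Lr A (subst_val e xs ts)), Wn = (\<lambda>e. Wn A (subst_val e xs ts)) \<rparr>"

definition g_neg :: "game \<Rightarrow> game" where
  "g_neg A = \<lparr> Lr = (\<lambda>e. {\<Gamma>. neg_run \<Gamma> \<in> Lr A e}),
               Wn = (\<lambda>e \<Gamma>. opp (Wn A e (neg_run \<Gamma>))) \<rparr>"

text \<open>In the following list-indexed operations \<open>A\<^sub>i\<close> is \<open>As ! (i - 1)\<close>, for \<open>1 \<le> i \<le> length As\<close>.\<close>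

definition g_and :: "game list \<Rightarrow> game" where
  "g_and As = mk_game
     (\<lambda>e. {\<Gamma>. (\<forall>l \<in> labmoves \<Gamma>. \<exists>i \<in> {1..length As}. strip (component i) l \<noteq> None) \<and>
              (\<forall>i \<in> {1..length As}. subrun (component i) \<Gamma> \<in> Lr (As ! (i - 1)) e)})
     (\<lambda>e \<Gamma>. if \<forall>i \<in> {1..length As}. Wn (As ! (i - 1)) e (subrun (component i) \<Gamma>) = Machine
             then Machine else Environment)"

definition g_or :: "game list \<Rightarrow> game" where
  "g_or As = g_neg (g_and (map g_neg As))"

definition g_imp :: "game \<Rightarrow> game \<Rightarrow> game" where
  "g_imp A B = g_or [g_neg A, B]"

definition g_cand :: "game list \<Rightarrow> game" where
  "g_cand As = mk_game
     (\<lambda>e. {Fin []} \<union>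
          {cons_run (Environment, decimal i) \<Delta> |i \<Delta>.
             i \<in> {1..length As} \<and> \<Delta> \<in> Lr (As ! (i - 1)) e})
     (\<lambda>e \<Gamma>. if \<exists>i \<in> {1..length As}. \<exists>\<Delta>. \<Gamma> = cons_run (Environment, decimal i) \<Delta> \<and>
                  Wn (As ! (i - 1)) e \<Delta> = Environment
             then Environment else Machine)"

definition g_cor :: "game list \<Rightarrow> game" where
  "g_cor As = g_neg (g_cand (map g_neg As))"

definition g_call :: "var \<Rightarrow> game \<Rightarrow> game" where
  "g_call x A = mk_game
     (\<lambda>e. {Fin []} \<union>
          {cons_run (Environment, decimal c) \<Delta> |c \<Delta>. \<Delta> \<in> Lr (g_subst A [x] [Const c]) e})
     (\<lambda>e \<Gamma>. if \<exists>c \<Delta>. \<Gamma> = cons_run (Environment, decimal c) \<Delta> \<and>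
                  Wn (g_subst A [x] [Const c]) e \<Delta> = Environment
             then Environment else Machine)"

definition g_cex :: "var \<Rightarrow> game \<Rightarrow> game" where
  "g_cex x A = g_neg (g_call x (g_neg A))"

definition g_all :: "var \<Rightarrow> game \<Rightarrow> game" where
  "g_all x A = mk_game (Lr A)
     (\<lambda>e \<Gamma>. if \<forall>c. Wn (g_subst A [x] [Const c]) e \<Gamma> = Machine
             then Machine else Environment)"

definition g_ex :: "var \<Rightarrow> game \<Rightarrow> game" where
  "g_ex x A = g_neg (g_all x (g_neg A))"


section \<open>Hard-play machines\<close>

text \<open>
  All tapes are infinite to the right only. The valuation tape spells the constants
  \<open>e(v\<^sub>0), e(v\<^sub>1), \<dots>\<close> in decimal notation, each followed by a blank; the run tape spells the
  labmoves of the current position one after another, followed by blanks. \<open>Aux\<close> symbols occur on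
  the work tape only.
\<close>

datatype cell = Blank | Sym symbol | Label player | Aux nat

definition valuation_tape :: "valuation \<Rightarrow> nat \<Rightarrow> cell" where
  "valuation_tape e k =
     concat (map (\<lambda>i. map Sym (decimal (e i)) @ [Blank]) [0..<Suc k]) ! k"

definition run_tape :: "labmove list \<Rightarrow> nat \<Rightarrow> cell" where
  "run_tape \<Phi> k =
     (let s = concat (map (\<lambda>(p, \<alpha>). Label p # map Sym \<alpha>) \<Phi>)
      in if k < length s then s ! k else Blank)"

datatype dir = Left | Stay | Right

text \<open>A head that is told to move left from the first cell stays there.\<close>

fun shift :: "dir \<Rightarrow> nat \<Rightarrow> nat" where
  "shift Left k = k - 1"
| "shift Stay k = k"
| "shift Right k = Suc k"

text \<open>
  The transition function takes the state and the cells scanned on the work, valuation and run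
  tapes to the next state, the symbol written on the work tape and the directions in which the
  work, valuation and run heads move.
\<close>

record hpm =
  states :: "nat set"
  start :: nat
  move_states :: "nat set"
  work_alphabet :: "cell set"
  trans :: "nat \<Rightarrow> cell \<Rightarrow> cell \<Rightarrow> cell \<Rightarrow> nat \<times> cell \<times> dir \<times> dir \<times> dir"

definition is_hpm :: "hpm \<Rightarrow> bool" where
  "is_hpm M \<longleftrightarrow>
     finite (states M) \<and> start M \<in> states M \<and> move_states M \<subseteq> states M \<and>
     finite (work_alphabet M) \<and> Blank \<in> work_alphabet M \<and>
     (\<forall>q \<in> states M. \<forall>w \<in> work_alphabet M. \<forall>v r q' w' ds.
        trans M q w v r = (q', w', ds) \<longrightarrow> q' \<in> states M \<and> w' \<in> work_alphabet M)"

record config =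
  state :: nat
  work :: "nat \<Rightarrow> cell"
  work_head :: nat
  val_head :: nat
  run_head :: nat
  position :: "labmove list"

definition init_config :: "hpm \<Rightarrow> config" where
  "init_config M = \<lparr> state = start M, work = (\<lambda>_. Blank),
     work_head = 0, val_head = 0, run_head = 0, position = [] \<rparr>"

text \<open>
  The move made in a move state: the string on the work tape from its first cell up to (excluding)
  the first cell not containing a symbol of the move alphabet.
\<close>

definition written_move :: "(nat \<Rightarrow> cell) \<Rightarrow> move" where
  "written_move t = map (\<lambda>k. THE s. t k = Sym s) [0..<(LEAST k. t k \<notin> range Sym)]"

definition machine_step :: "hpm \<Rightarrow> valuation \<Rightarrow> config \<Rightarrow> config" where
  "machine_step M e C =
     (case trans M (state C) (work C (work_head C)) (valuation_tape e (val_head C))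
             (run_tape (position C) (run_head C)) of
        (q, w, d1, d2, d3) \<Rightarrow>
          \<lparr> state = q, work = (work C)(work_head C := w),
            work_head = shift d1 (work_head C),
            val_head = shift d2 (val_head C),
            run_head = shift d3 (run_head C),
            position = position C @
              (if state C \<in> move_states M then [(Machine, written_move (work C))] else []) \<rparr>)"

definition successor :: "hpm \<Rightarrow> valuation \<Rightarrow> config \<Rightarrow> config \<Rightarrow> bool" where
  "successor M e C C' \<longleftrightarrow>
     (\<exists>\<beta>s. C' = (machine_step M e C)
              \<lparr> position := position (machine_step M e C) @ map (Pair Environment) \<beta>s \<rparr>)"

definition computation :: "hpm \<Rightarrow> valuation \<Rightarrow> (nat \<Rightarrow> config) \<Rightarrow> bool" where
  "computation M e B \<longleftrightarrow> B 0 = init_config M \<and> (\<forall>i. successor M e (B i) (B (Suc i)))"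

text \<open>The run whose finite initial segments are those of the growing positions on the run tape.\<close>

definition generated_run :: "(nat \<Rightarrow> config) \<Rightarrow> run" where
  "generated_run B =
     (if \<exists>N. \<forall>i\<ge>N. position (B i) = position (B N)
      then Fin (position (B (LEAST N. \<forall>i\<ge>N. position (B i) = position (B N))))
      else Inf (\<lambda>n. position (B (LEAST i. n < length (position (B i)))) ! n))"

definition wins :: "hpm \<Rightarrow> game \<Rightarrow> bool" where
  "wins M A \<longleftrightarrow> (\<forall>e B. computation M e B \<longrightarrow> Wn A e (generated_run B) = Machine)"

definition computable :: "game \<Rightarrow> bool" where
  "computable A \<longleftrightarrow> (\<exists>M. is_hpm M \<and> wins M A)"


section \<open>Formulas, interpretations, validity\<close>

text \<open>
  A predicate letter is determined by a name and an arity: the letter of \<open>Atom p ts\<close> is the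
  \<open>length ts\<close>-ary letter named \<open>p\<close>. \<open>And\<close>, \<open>Or\<close> are the parallel and \<open>CAnd\<close>, \<open>COr\<close> the choice
  connectives; \<open>All\<close>, \<open>Ex\<close> are the blind and \<open>CAll\<close>, \<open>CEx\<close> the choice quantifiers.
\<close>

datatype fm =
    Atom nat "tm list"
  | Top
  | Bot
  | Neg fm
  | And "fm list"
  | Or "fm list"
  | Imp fm fm
  | CAnd "fm list"
  | COr "fm list"
  | All var fm
  | Ex var fm
  | CAll var fm
  | CEx var fm

text \<open>All variables occurring in a formula: free, bound, or next to a quantifier.\<close>

fun fm_vars :: "fm \<Rightarrow> var set" where
  "fm_vars (Atom p ts) = {x. Var x \<in> set ts}"
| "fm_vars Top = {}"
| "fm_vars Bot = {}"
| "fm_vars (Neg F) = fm_vars F"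
| "fm_vars (And Fs) = (\<Union>F \<in> set Fs. fm_vars F)"
| "fm_vars (Or Fs) = (\<Union>F \<in> set Fs. fm_vars F)"
| "fm_vars (Imp F G) = fm_vars F \<union> fm_vars G"
| "fm_vars (CAnd Fs) = (\<Union>F \<in> set Fs. fm_vars F)"
| "fm_vars (COr Fs) = (\<Union>F \<in> set Fs. fm_vars F)"
| "fm_vars (All x F) = insert x (fm_vars F)"
| "fm_vars (Ex x F) = insert x (fm_vars F)"
| "fm_vars (CAll x F) = insert x (fm_vars F)"
| "fm_vars (CEx x F) = insert x (fm_vars F)"

text \<open>
  \<open>I p n = (A, xs)\<close> says that the \<open>n\<close>-ary letter named \<open>p\<close> is interpreted as the game \<open>A\<close> with
  attached tuple \<open>xs\<close>.
\<close>

type_synonym interp = "nat \<Rightarrow> nat \<Rightarrow> game \<times> var list"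

definition is_interp :: "interp \<Rightarrow> bool" where
  "is_interp I \<longleftrightarrow>
     (\<forall>p n A xs. I p n = (A, xs) \<longrightarrow> elementary A \<and> length xs = n \<and> distinct xs)"

definition admissible :: "fm \<Rightarrow> interp \<Rightarrow> bool" where
  "admissible F I \<longleftrightarrow>
     (\<forall>p n A xs. I p n = (A, xs) \<longrightarrow> (\<forall>x \<in> fm_vars F - set xs. \<not> depends_on A x))"

fun fm_game :: "interp \<Rightarrow> fm \<Rightarrow> game" where
  "fm_game I (Atom p ts) = (case I p (length ts) of (A, xs) \<Rightarrow> g_subst A xs ts)"
| "fm_game I Top = g_top"
| "fm_game I Bot = g_bot"
| "fm_game I (Neg F) = g_neg (fm_game I F)"
| "fm_game I (And Fs) = g_and (map (fm_game I) Fs)"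
| "fm_game I (Or Fs) = g_or (map (fm_game I) Fs)"
| "fm_game I (Imp F G) = g_imp (fm_game I F) (fm_game I G)"
| "fm_game I (CAnd Fs) = g_cand (map (fm_game I) Fs)"
| "fm_game I (COr Fs) = g_cor (map (fm_game I) Fs)"
| "fm_game I (All x F) = g_all x (fm_game I F)"
| "fm_game I (Ex x F) = g_ex x (fm_game I F)"
| "fm_game I (CAll x F) = g_call x (fm_game I F)"
| "fm_game I (CEx x F) = g_cex x (fm_game I F)"

definition valid :: "fm \<Rightarrow> bool" where
  "valid F \<longleftrightarrow> (\<forall>I. is_interp I \<and> admissible F I \<longrightarrow> computable (fm_game I F))"

definition uniformly_valid :: "fm \<Rightarrow> bool" where
  "uniformly_valid F \<longleftrightarrow>
     (\<exists>M. is_hpm M \<and> (\<forall>I. is_interp I \<and> admissible F I \<longrightarrow> wins M (fm_game I F)))"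

end

theory Submission
  imports Defs "HOL-Library.Countable_Set"
begin

text \<open>
  Suppose that no machine wins \<open>F\<close> uniformly, and let \<open>z\<close> be a variable exceeding all variables of
  \<open>F\<close>. An admissible interpretation may depend on \<open>z\<close>, so a single interpretation can confront
  each of countably many machines \<open>M\<close> with an opponent of its own, provided \<open>M\<close> is beaten at some
  valuation whose value at \<open>z\<close> is reserved for \<open>M\<close>. For this it suffices that every machine is
  beaten at valuations with arbitrarily large values at \<open>z\<close>. Given \<open>M\<close> and a number \<open>c > 0\<close>,
  consider the machine that runs \<open>M\<close> but makes it see the digits of \<open>c\<close> in front of the value
  of every variable whose index is a positive multiple of \<open>z\<close>. Finite memory suffices, as a
  two-way head can keep track of the index of the scanned variable modulo \<open>z\<close>, and none of the
  altered variables occurs in \<open>F\<close>. This machine is beaten somewhere, hence \<open>M\<close> is beaten at a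
  valuation with a value of at least \<open>c\<close> at \<open>z\<close>.
\<close>

section \<open>Games agreeing at given valuations\<close>

text \<open>Two valuations are compared because a loss is suffered at one valuation while the beaten
  machine reads another on its tape.\<close>

definition agree :: "game \<Rightarrow> valuation \<Rightarrow> game \<Rightarrow> valuation \<Rightarrow> bool" where
  "agree A e B e' \<longleftrightarrow> Lr A e = Lr B e' \<and> Wn A e = Wn B e'"

lemma subst_val_single: "subst_val e [x] [Const c] = e(x := c)"
  by (auto simp: subst_val_def)

section \<open>Compatibility of the game operations with agreement\<close>

lemma agree_mk_game:
  assumes "L e = L' e'" and "\<And>\<Gamma>. W e \<Gamma> = W' e' \<Gamma>"
  shows "agree (mk_game L W) e (mk_game L' W') e'"
  using assms by (simp add: agree_def mk_game_def fun_eq_iff)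

lemma agree_g_neg: "agree A e B e' \<Longrightarrow> agree (g_neg A) e (g_neg B) e'"
  by (simp add: agree_def g_neg_def)

lemma agree_nth:
  "list_all2 (\<lambda>A B. agree A e B e') As Bs \<Longrightarrow> i \<in> {1..length Bs} \<Longrightarrow>
   Lr (As ! (i - 1)) e = Lr (Bs ! (i - 1)) e' \<and> Wn (As ! (i - 1)) e = Wn (Bs ! (i - 1)) e'"
  by (auto simp: list_all2_conv_all_nth agree_def)

lemma agree_g_and:
  assumes "list_all2 (\<lambda>A B. agree A e B e') As Bs"
  shows "agree (g_and As) e (g_and Bs) e'"
proof -
  have [simp]: "length As = length Bs"
    using assms by (rule list_all2_lengthD)
  show ?thesis
    unfolding g_and_def
    by (rule agree_mk_game) (use agree_nth[OF assms] in \<open>simp_all cong: ball_cong del: atLeastAtMost_iff\<close>)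
qed

lemma agree_map_g_neg:
  "list_all2 (\<lambda>A B. agree A e B e') As Bs \<Longrightarrow>
   list_all2 (\<lambda>A B. agree A e B e') (map g_neg As) (map g_neg Bs)"
  by (auto simp: list_all2_conv_all_nth agree_g_neg)

lemma agree_g_or:
  "list_all2 (\<lambda>A B. agree A e B e') As Bs \<Longrightarrow> agree (g_or As) e (g_or Bs) e'"
  by (simp add: g_or_def agree_g_neg agree_g_and agree_map_g_neg)

lemma agree_g_imp:
  "agree A e A' e' \<Longrightarrow> agree B e B' e' \<Longrightarrow> agree (g_imp A B) e (g_imp A' B') e'"
  by (simp add: g_imp_def agree_g_neg agree_g_or)

lemma agree_g_cand:
  assumes "list_all2 (\<lambda>A B. agree A e B e') As Bs"
  shows "agree (g_cand As) e (g_cand Bs) e'"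
proof -
  have [simp]: "length As = length Bs"
    using assms by (rule list_all2_lengthD)
  have "{cons_run (Environment, decimal i) \<Delta> |i \<Delta>.
          i \<in> {1..length Bs} \<and> \<Delta> \<in> Lr (As ! (i - 1)) e} =
        {cons_run (Environment, decimal i) \<Delta> |i \<Delta>.
          i \<in> {1..length Bs} \<and> \<Delta> \<in> Lr (Bs ! (i - 1)) e'}"
    using agree_nth[OF assms] by blast
  then show ?thesis
    unfolding g_cand_def
    by (intro agree_mk_game) (use agree_nth[OF assms] in \<open>simp_all cong: bex_cong del: atLeastAtMost_iff\<close>)
qed

lemma agree_g_cor:
  "list_all2 (\<lambda>A B. agree A e B e') As Bs \<Longrightarrow> agree (g_cor As) e (g_cor Bs) e'"
  by (simp add: g_cor_def agree_g_neg agree_g_cand agree_map_g_neg)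

lemma agree_g_call:
  assumes "\<And>c. agree A (e(x := c)) B (e'(x := c))"
  shows "agree (g_call x A) e (g_call x B) e'"
  unfolding g_call_def
  by (rule agree_mk_game)
    (use assms in \<open>simp_all add: g_subst_def subst_val_single agree_def\<close>)

lemma agree_g_cex:
  "(\<And>c. agree A (e(x := c)) B (e'(x := c))) \<Longrightarrow> agree (g_cex x A) e (g_cex x B) e'"
  by (simp add: g_cex_def agree_g_neg agree_g_call)

text \<open>The legal runs of \<open>g_all x A\<close> at \<open>e\<close> are those of
  \<open>A\<close> at \<open>e\<close> itself, not at an updated valuation; hence the second
  premise.\<close>

lemma agree_g_all:
  assumes "\<And>c. agree A (e(x := c)) B (e'(x := c))" and "agree A e B e'"
  shows "agree (g_all x A) e (g_all x B) e'"
  unfolding g_all_def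
  by (rule agree_mk_game)
    (use assms in \<open>simp_all add: g_subst_def subst_val_single agree_def\<close>)

lemma agree_g_ex:
  "(\<And>c. agree A (e(x := c)) B (e'(x := c))) \<Longrightarrow> agree A e B e' \<Longrightarrow>
   agree (g_ex x A) e (g_ex x B) e'"
  by (simp add: g_ex_def agree_g_neg agree_g_all)

text \<open>Quantifiers pass to updated valuations, so the induction needs a relation that survives
  equal updates of both sides at variables of \<open>V\<close>; \<open>V\<close> stays fixed while
  the formula shrinks.\<close>

lemma fm_game_cong:
  assumes upd: "\<And>e e' x c. R e e' \<Longrightarrow> x \<in> V \<Longrightarrow> R (e(x := c)) (e'(x := c))"
    and atom: "\<And>e e' p ts. R e e' \<Longrightarrow> {x. Var x \<in> set ts} \<subseteq> V \<Longrightarrow>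
      agree (fm_game I (Atom p ts)) e (fm_game J (Atom p ts)) e'"
    and "fm_vars F \<subseteq> V" and "R e e'"
  shows "agree (fm_game I F) e (fm_game J F) e'"
  using assms(3,4)
proof (induction F arbitrary: e e')
  case (Atom p ts)
  then show ?case by (intro atom) auto
next
  case (And Fs)
  then show ?case
    by (auto intro!: agree_g_and simp: list_all2_conv_all_nth UN_subset_iff)
next
  case (Or Fs)
  then show ?case
    by (auto intro!: agree_g_or simp: list_all2_conv_all_nth UN_subset_iff)
next
  case (CAnd Fs)
  then show ?case
    by (auto intro!: agree_g_cand simp: list_all2_conv_all_nth UN_subset_iff)
next
  case (COr Fs)
  then show ?case
    by (auto intro!: agree_g_cor simp: list_all2_conv_all_nth UN_subset_iff)
qed (auto intro!: agree_g_neg agree_g_imp agree_g_all agree_g_ex agree_g_call agree_g_cex upd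
       simp: g_top_def g_bot_def agree_mk_game)

section \<open>Independence of variables and elementary games\<close>

lemma finite_fm_vars: "finite (fm_vars F)"
proof (induction F)
  case (Atom p ts)
  have "fm_vars (Atom p ts) = Var -` set ts"
    by auto
  then show ?case
    by (simp add: finite_vimageI inj_def)
qed auto

text \<open>\<open>depends_on\<close> compares valuations that differ at one variable, so the
  variables of \<open>S\<close> are changed one at a time.\<close>

lemma agree_if_not_depends_on:
  assumes "finite S" and "\<forall>x\<in>S. \<not> depends_on A x" and "\<forall>x. x \<notin> S \<longrightarrow> e x = e' x"
  shows "agree A e A e'"
  using assms
proof (induction S arbitrary: e rule: finite_induct)
  case empty
  then have "e = e'" by auto
  then show ?case by (simp add: agree_def)
next
  case (insert x S)
  have "agree A (e(x := e' x)) A e'"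
    using insert by (intro insert.IH) auto
  moreover have "agree A e A (e(x := e' x))"
    using insert.prems(1) unfolding depends_on_def agree_def
    by (metis fun_upd_other insertI1)
  ultimately show ?case by (simp add: agree_def)
qed

text \<open>A run other than \<open>Fin []\<close> has a nonempty initial segment, which is illegal;
  so every \<open>W\<close>, computable or not, yields an elementary game.\<close>

lemma elementary_mk_game: "elementary (mk_game (\<lambda>_. {Fin []}) W)"
proof -
  have "\<exists>n. init_seg n \<Gamma> \<noteq> []" if "\<Gamma> \<noteq> Fin []" for \<Gamma>
  proof (cases \<Gamma>)
    case (Fin xs)
    then show ?thesis
      using that by (intro exI[of _ "length xs"]) auto
  next
    case (Inf f)
    then show ?thesis by (intro exI[of _ 1]) auto
  qed
  then show ?thesis
    by (fastforce simp: elementary_def is_game_def mk_game_def)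
qed

text \<open>On a nonempty run the winner is forced by the common set of legal runs, so the outcome
  of the empty run decides everything.\<close>

lemma agree_elementary:
  assumes "elementary A" "elementary B" "Wn A e (Fin []) = Wn B e' (Fin [])"
  shows "agree A e B e'"
proof -
  have "Wn A e \<Gamma> = Wn B e' \<Gamma>" for \<Gamma>
    using assms by (cases "\<Gamma> = Fin []") (auto simp: elementary_def is_game_def)
  then show ?thesis
    using assms by (auto simp: agree_def elementary_def)
qed

section \<open>Hard-play machines are countable up to behaviour\<close>

instance symbol :: countable by countable_datatype
instance player :: countable by countable_datatype
instance cell :: countable by countable_datatype
instance dir :: countable by countable_datatype

text \<open>The cells that the valuation and run tapes can show; unlike the type \<open>cell\<close>
  with its infinitely many \<open>Aux\<close> symbols, they form a finite set.\<close>

definition input_cells :: "cell set" where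
  "input_cells = insert Blank (range Sym \<union> range Label)"

lemma finite_input_cells: "finite input_cells"
proof -
  have "(UNIV :: symbol set) = insert Spade (range Key)"
    by (auto intro: symbol.exhaust)
  then have "finite (UNIV :: symbol set)"
    by (metis finite finite_imageI finite_insert)
  moreover have "(UNIV :: player set) = {Machine, Environment}"
    by (auto intro: player.exhaust)
  then have "finite (UNIV :: player set)"
    by (metis finite.emptyI finite_insert)
  ultimately show ?thesis
    by (simp add: input_cells_def)
qed

lemma run_tape_input: "run_tape \<Phi> k \<in> input_cells"
proof -
  have "set (concat (map (\<lambda>(p, \<alpha>). Label p # map Sym \<alpha>) \<Phi>)) \<subseteq> input_cells"
    by (auto simp: input_cells_def)
  then show ?thesis
    unfolding run_tape_def Let_def
    by (metis (no_types, lifting) input_cells_def insertI1 nth_mem subsetD)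
qed

section \<open>Layout of the valuation tape\<close>

definition val_start :: "valuation \<Rightarrow> nat \<Rightarrow> nat" where
  "val_start e i = (\<Sum>j<i. Suc (length (decimal (e j))))"

lemma val_start_simps [simp]:
  "val_start e 0 = 0"
  "val_start e (Suc i) = val_start e i + Suc (length (decimal (e i)))"
  by (simp_all add: val_start_def)

lemma val_start_ge: "i \<le> val_start e i"
  by (induction i) auto

lemma valuation_tape_at:
  assumes "k \<le> length (decimal (e i))"
  shows "valuation_tape e (val_start e i + k) =
    (if k < length (decimal (e i)) then Sym (decimal (e i) ! k) else Blank)"
proof -
  let ?f = "\<lambda>i. map Sym (decimal (e i)) @ [Blank]"
  have len: "length (concat (map ?f [0..<i])) = val_start e i"
    by (induction i) auto
  \<comment> \<open>A cell is computed from the blocks whose index does not exceed its own; as no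
    block is empty, block \<open>i\<close> is among them.\<close>
  obtain d where "Suc (val_start e i + k) = i + Suc d"
    using val_start_ge[of i e] by (metis add_Suc_right le_add_diff_inverse trans_le_add1)
  then have "[0..<Suc (val_start e i + k)] = [0..<i] @ i # [Suc i..<Suc (val_start e i + k)]"
    using upt_add_eq_append[of 0 i "Suc d"] by (simp add: upt_conv_Cons del: upt_Suc)
  then show ?thesis
    unfolding valuation_tape_def using assms len
    by (simp add: nth_append del: upt_Suc)
qed

lemma val_position:
  obtains i k where "p = val_start e i + k" "k \<le> length (decimal (e i))"
proof (induction p arbitrary: thesis)
  case 0
  then show ?case by (metis add_0 le0 val_start_simps(1))
next
  case (Suc p)
  obtain i k where ik: "p = val_start e i + k" "k \<le> length (decimal (e i))"
    using Suc.IH by blast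
  show ?case
  proof (cases "k < length (decimal (e i))")
    case True
    then show ?thesis using Suc.prems[of i "Suc k"] ik by simp
  next
    case False
    then show ?thesis using Suc.prems[of "Suc i" 0] ik by simp
  qed
qed

lemma valuation_tape_input: "valuation_tape e p \<in> input_cells"
  by (rule val_position[of p e]) (simp add: valuation_tape_at input_cells_def)

text \<open>Transition functions are uncountably many; this finite graph keeps only the entries that
  a computation can consult.\<close>

definition program ::
  "hpm \<Rightarrow> ((nat \<times> cell \<times> cell \<times> cell) \<times> (nat \<times> cell \<times> dir \<times> dir \<times> dir)) set" where
  "program M = (\<lambda>(q, w, v, r). ((q, w, v, r), trans M q w v r)) `
     (states M \<times> work_alphabet M \<times> input_cells \<times> input_cells)"

definition behaviour where
  "behaviour M = (start M, move_states M, program M)"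

lemma countable_behaviours: "countable (behaviour ` Collect is_hpm)"
proof (rule countable_subset)
  show "behaviour ` Collect is_hpm \<subseteq> UNIV \<times> Collect finite \<times> Collect finite"
  proof (rule image_subsetI)
    fix M assume "M \<in> Collect is_hpm"
    then have "finite (states M)" "finite (work_alphabet M)" "finite (move_states M)"
      by (auto simp: is_hpm_def dest: finite_subset)
    then show "behaviour M \<in> UNIV \<times> Collect finite \<times> Collect finite"
      by (simp add: behaviour_def program_def finite_input_cells)
  qed
  show "countable ((UNIV :: nat set) \<times> (Collect finite :: nat set set) \<times>
    (Collect finite :: ((nat \<times> cell \<times> cell \<times> cell) \<times> (nat \<times> cell \<times> dir \<times> dir \<times> dir)) set set))"
    by (intro countable_SIGMA countable_Collect_finite) simp
qed

lemma computation_reachable: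
  assumes "is_hpm M" "computation M e B"
  shows "state (B i) \<in> states M \<and> (\<forall>k. work (B i) k \<in> work_alphabet M)"
proof (induction i)
  case 0
  then show ?case
    using assms by (auto simp: computation_def init_config_def is_hpm_def)
next
  case (Suc i)
  obtain \<beta>s where "B (Suc i) = (machine_step M e (B i))
      \<lparr>position := position (machine_step M e (B i)) @ map (Pair Environment) \<beta>s\<rparr>"
    using assms(2) by (auto simp: computation_def successor_def)
  moreover obtain q w ds where tr: "trans M (state (B i)) (work (B i) (work_head (B i)))
      (valuation_tape e (val_head (B i))) (run_tape (position (B i)) (run_head (B i))) = (q, w, ds)"
    using prod_cases3 by blast
  moreover have "q \<in> states M" "w \<in> work_alphabet M"
    using Suc assms(1) tr unfolding is_hpm_def by blast+
  ultimately show ?case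
    using Suc by (simp add: machine_step_def case_prod_unfold)
qed

text \<open>A computation stays within \<open>states M\<close> and \<open>work_alphabet M\<close>
  and reads only input cells, so each step uses an entry of \<open>program M\<close>.\<close>

lemma computation_if_same_behaviour:
  assumes "is_hpm M" "behaviour M = behaviour N" "computation M e B"
  shows "computation N e B"
proof -
  have "machine_step N e (B i) = machine_step M e (B i)" for i
  proof -
    let ?q = "state (B i)" and ?w = "work (B i) (work_head (B i))"
      and ?v = "valuation_tape e (val_head (B i))"
      and ?r = "run_tape (position (B i)) (run_head (B i))"
    have "((?q, ?w, ?v, ?r), trans M ?q ?w ?v ?r) \<in> program M"
      unfolding program_def
      by (rule image_eqI[where x = "(?q, ?w, ?v, ?r)"])
        (use computation_reachable[OF assms(1,3)] run_tape_input valuation_tape_input in auto)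
    also have "program M = program N"
      using assms(2) by (simp add: behaviour_def)
    finally have "trans M ?q ?w ?v ?r = trans N ?q ?w ?v ?r"
      by (auto simp: program_def)
    then show ?thesis
      using assms(2) by (simp add: machine_step_def behaviour_def)
  qed
  then show ?thesis
    using assms(2,3)
    by (simp add: computation_def successor_def init_config_def behaviour_def)
qed

text \<open>\<open>from_nat_into\<close> enumerates the behaviours and \<open>inv_into\<close> picks
  a machine for each; \<open>M\<^sub>0\<close> keeps the enumerated set nonempty.\<close>

lemma enumerate_hpms:
  assumes "is_hpm M\<^sub>0"
  shows "\<exists>Ms :: nat \<Rightarrow> hpm. (\<forall>n. is_hpm (Ms n)) \<and>
    (\<forall>M. is_hpm M \<longrightarrow> (\<exists>n. \<forall>e B. computation (Ms n) e B \<longrightarrow> computation M e B))"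
proof -
  let ?S = "behaviour ` Collect is_hpm"
  define Ms where "Ms n = inv_into (Collect is_hpm) behaviour (from_nat_into ?S n)" for n
  have in_S: "from_nat_into ?S n \<in> ?S" for n
    using assms by (intro from_nat_into) auto
  have hpm: "is_hpm (Ms n)" for n
    using inv_into_into[OF in_S[of n]] by (simp add: Ms_def)
  have "\<exists>n. \<forall>e B. computation (Ms n) e B \<longrightarrow> computation M e B" if M: "is_hpm M" for M
  proof -
    obtain n where "from_nat_into ?S n = behaviour M"
      using M countable_behaviours by (metis (no_types) from_nat_into_surj image_eqI mem_Collect_eq)
    then have "behaviour (Ms n) = behaviour M"
      using f_inv_into_f[OF in_S[of n]] by (simp add: Ms_def)
    then show ?thesis
      using computation_if_same_behaviour[OF hpm] by blast
  qed
  with hpm show ?thesis by blast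
qed

section \<open>Simulating a machine on a padded valuation\<close>

definition prepend :: "nat \<Rightarrow> nat \<Rightarrow> nat" where
  "prepend c n = c * 10 ^ length (decimal n) + n"

text \<open>The induction drops the last digit, which \<open>n\<close> shares with
  \<open>prepend c n\<close>. For \<open>c = 0\<close> the right-hand side would have a leading
  zero.\<close>

lemma decimal_prepend:
  assumes "0 < c"
  shows "decimal (prepend c n) = decimal c @ decimal n"
proof (induction n rule: decimal.induct)
  case (1 n)
  show ?case
  proof (cases "n < 10")
    case True
    then have "decimal n = [Key (char_of (48 + n))]"
      by (simp add: decimal.simps[of n])
    then show ?thesis
      using True assms by (simp add: prepend_def decimal.simps[of "c * 10 + n"])
  next
    case False
    then have n: "decimal n = decimal (n div 10) @ [Key (char_of (48 + n mod 10))]"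
      by (simp add: decimal.simps[of n])
    let ?N = "prepend c n"
    have N: "?N = c * 10 ^ length (decimal (n div 10)) * 10 + n"
      by (simp add: prepend_def n)
    have "?N div 10 = prepend c (n div 10)"
      by (simp add: N prepend_def[of c "n div 10"])
    moreover have "?N mod 10 = n mod 10"
      by (simp add: N)
    moreover have "\<not> ?N < 10"
      using False by (simp add: N)
    ultimately have "decimal ?N = decimal (prepend c (n div 10)) @ [Key (char_of (48 + n mod 10))]"
      by (simp add: decimal.simps[of ?N])
    then show ?thesis
      using 1 False n by simp
  qed
qed

lemma decimal_nonempty: "decimal n \<noteq> []"
  by (simp add: decimal.simps[of n])

text \<open>Index 0 is exempt: no blank precedes its block to stand for inserted digits, and
  \<open>v_0\<close> may occur in the formula.\<close>

definition pad :: "nat \<Rightarrow> nat \<Rightarrow> valuation \<Rightarrow> valuation" where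
  "pad m c e = (\<lambda>i. if 0 < i \<and> i mod m = 0 then prepend c (e i) else e i)"

text \<open>
  The padded machine keeps, in its state, the state \<open>q\<close> of \<open>M\<close>, the index \<open>b\<close> modulo \<open>m\<close> of the
  block scanned on the valuation tape, and a number \<open>a\<close>. A blank that precedes a padded block
  stands for itself followed by the digits of \<open>c\<close>, and \<open>a \<le> length (decimal c)\<close> tells which of
  these cells the simulated head scans. The remaining value \<open>a = Suc (length (decimal c))\<close> says
  that the head has just been sent to the left; whether this changed the block becomes known only
  when the new cell is read, and \<open>resolve\<close> makes the correction.
\<close>

definition resolve :: "nat \<Rightarrow> nat \<Rightarrow> nat \<Rightarrow> nat \<Rightarrow> cell \<Rightarrow> nat \<times> nat" where
  "resolve m l b a v =
     (if a \<le> l then (b, a)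
      else if v = Blank then (if b = 0 then (m - 1, l) else (b - 1, 0))
      else (b, 0))"

text \<open>While the simulated head crosses inserted digits, the real head waits on the blank and
  only \<open>j\<close> changes. The block index advances when the real head leaves the blank to the
  right; after a left move it is left to \<open>resolve\<close>.\<close>

fun move_val :: "nat \<Rightarrow> nat \<Rightarrow> nat \<Rightarrow> nat \<Rightarrow> cell \<Rightarrow> dir \<Rightarrow> nat \<times> nat \<times> dir" where
  "move_val m l b j v Stay = (b, j, Stay)"
| "move_val m l b j v Right =
     (if v = Blank \<and> Suc b mod m = 0 \<and> j < l then (b, Suc j, Stay)
      else if v = Blank then (Suc b mod m, 0, Right)
      else (b, 0, Right))"
| "move_val m l b j v Left = (if 0 < j then (b, j - 1, Stay) else (b, Suc l, Left))"

definition padded_trans where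
  "padded_trans M m c s w v r =
     (case prod_decode s of (q, s') \<Rightarrow> case prod_decode s' of (b, a) \<Rightarrow>
      case resolve m (length (decimal c)) b a v of (b', j) \<Rightarrow>
      case trans M q w (if j = 0 then v else Sym (decimal c ! (j - 1))) r of (q', w', d1, d2, d3) \<Rightarrow>
      case move_val m (length (decimal c)) b' j v d2 of (b'', a'', d2') \<Rightarrow>
        (prod_encode (q', prod_encode (b'', a'')), w', d1, d2', d3))"

definition padded :: "hpm \<Rightarrow> nat \<Rightarrow> nat \<Rightarrow> hpm" where
  "padded M m c =
     (let E = \<lambda>Q. (\<lambda>(q, b, a). prod_encode (q, prod_encode (b, a))) `
                   (Q \<times> {..<m} \<times> {..Suc (length (decimal c))})
      in \<lparr> states = E (states M), start = prod_encode (start M, prod_encode (0, 0)),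
           move_states = E (move_states M), work_alphabet = work_alphabet M,
           trans = padded_trans M m c \<rparr>)"

lemma resolve_bounds:
  "resolve m l b a v = (b', j) \<Longrightarrow> b < m \<Longrightarrow> b' < m \<and> j \<le> l"
  by (auto simp: resolve_def split: if_splits)

lemma move_val_bounds:
  "move_val m l b j v d = (b', a, d') \<Longrightarrow> b < m \<Longrightarrow> j \<le> l \<Longrightarrow> b' < m \<and> a \<le> Suc l"
  by (cases d) (auto split: if_splits)

lemma is_hpm_padded:
  assumes "is_hpm M" "0 < m"
  shows "is_hpm (padded M m c)"
proof -
  have "q' \<in> states (padded M m c) \<and> w' \<in> work_alphabet M"
    if s_in: "s \<in> states (padded M m c)" and w_in: "w \<in> work_alphabet M"
      and trans: "padded_trans M m c s w v r = (q', w', ds)" for s w v r q' w' ds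
  proof -
    obtain q b a where s: "s = prod_encode (q, prod_encode (b, a))" "q \<in> states M" "b < m"
      using s_in by (auto simp: padded_def)
    obtain b' j where res: "resolve m (length (decimal c)) b a v = (b', j)"
      by fastforce
    obtain q1 w1 d1 d2 d3 where
      tr: "trans M q w (if j = 0 then v else Sym (decimal c ! (j - 1))) r = (q1, w1, d1, d2, d3)"
      using prod_cases5 by blast
    obtain b2 a2 d2' where mv: "move_val m (length (decimal c)) b' j v d2 = (b2, a2, d2')"
      using prod_cases3 by blast
    have "q1 \<in> states M" "w1 \<in> work_alphabet M"
      using assms(1) s(2) w_in tr unfolding is_hpm_def by blast+
    moreover have "b2 < m" "a2 \<le> Suc (length (decimal c))"
      using resolve_bounds[OF res s(3)] move_val_bounds[OF mv] by auto
    moreover have "q' = prod_encode (q1, prod_encode (b2, a2))" "w' = w1"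
      using trans by (auto simp: padded_trans_def s res tr mv)
    ultimately show ?thesis
      by (auto simp: padded_def intro!: image_eqI[where x = "(q1, b2, a2)"])
  qed
  moreover have "finite (states (padded M m c))"
    using assms(1) by (simp add: padded_def Let_def is_hpm_def)
  moreover have "start (padded M m c) \<in> states (padded M m c)"
    using assms by (auto simp: padded_def Let_def is_hpm_def
        intro!: image_eqI[where x = "(start M, 0, 0)"])
  moreover have "move_states (padded M m c) \<subseteq> states (padded M m c)"
    using assms(1) unfolding padded_def Let_def hpm.simps is_hpm_def
    by (intro image_mono Sigma_mono) auto
  moreover have "work_alphabet (padded M m c) = work_alphabet M"
      "trans (padded M m c) = padded_trans M m c"
    by (simp_all add: padded_def Let_def)
  ultimately show ?thesis
    using assms(1) unfolding is_hpm_def by metis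
qed

lemma move_states_padded:
  "b < m \<Longrightarrow> a \<le> Suc (length (decimal c)) \<Longrightarrow>
   prod_encode (q, prod_encode (b, a)) \<in> move_states (padded M m c) \<longleftrightarrow> q \<in> move_states M"
  by (auto simp: padded_def intro!: image_eqI[where x = "(q, b, a)"])

section \<open>Correspondence of head positions on the two valuation tapes\<close>

definition pad_length :: "nat \<Rightarrow> nat \<Rightarrow> nat \<Rightarrow> nat" where
  "pad_length m c i = (if 0 < i \<and> i mod m = 0 then length (decimal c) else 0)"

text \<open>The real head is at offset \<open>k\<close> of block \<open>i\<close>, of which only the
  residue \<open>b\<close> is kept. The last clause allows \<open>j > 0\<close> only on a blank
  before a padded block.\<close>

definition tracks :: "nat \<Rightarrow> nat \<Rightarrow> valuation \<Rightarrow> nat \<Rightarrow> nat \<Rightarrow> nat \<Rightarrow> nat \<Rightarrow> nat \<Rightarrow> bool" where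
  "tracks m c e h b j i k \<longleftrightarrow>
     h = val_start e i + k \<and> k \<le> length (decimal (e i)) \<and> b = i mod m \<and>
     j \<le> length (decimal c) \<and>
     (0 < j \<longrightarrow> k = length (decimal (e i)) \<and> Suc i mod m = 0)"

definition padded_head :: "nat \<Rightarrow> nat \<Rightarrow> valuation \<Rightarrow> nat \<Rightarrow> nat \<Rightarrow> nat \<Rightarrow> nat" where
  "padded_head m c e i k j = val_start (pad m c e) i + pad_length m c i + k + j"

lemma length_decimal_pad:
  "0 < c \<Longrightarrow> length (decimal (pad m c e i)) = pad_length m c i + length (decimal (e i))"
  by (simp add: pad_def pad_length_def decimal_prepend)

lemma tracks_tape:
  assumes "tracks m c e h b j i k" "0 < c"
  shows "valuation_tape (pad m c e) (padded_head m c e i k j) =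
    (if j = 0 then valuation_tape e h else Sym (decimal c ! (j - 1)))"
proof (cases "j = 0")
  case True
  have "decimal (pad m c e i) ! (pad_length m c i + k) = decimal (e i) ! k"
    using assms(2) by (simp add: pad_def pad_length_def decimal_prepend)
  then show ?thesis
    using assms True valuation_tape_at[of "pad_length m c i + k" "pad m c e" i]
      valuation_tape_at[of k e i]
    by (simp add: tracks_def padded_head_def length_decimal_pad add.assoc)
next
  case False
  then have j: "k = length (decimal (e i))" "Suc i mod m = 0" "j - 1 < length (decimal c)"
    using assms(1) by (auto simp: tracks_def)
  \<comment> \<open>The simulated head has passed the blank and scans an inserted digit, which is
    cell \<open>j - 1\<close> of block \<open>Suc i\<close>.\<close>
  then have "padded_head m c e i k j = val_start (pad m c e) (Suc i) + (j - 1)"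
    using False assms(2) by (simp add: padded_head_def length_decimal_pad)
  moreover have "decimal (pad m c e (Suc i)) ! (j - 1) = decimal c ! (j - 1)"
    "j - 1 < length (decimal (pad m c e (Suc i)))"
    using j assms(2) by (simp_all add: pad_def decimal_prepend nth_append)
  ultimately show ?thesis
    using False valuation_tape_at[of "j - 1" "pad m c e" "Suc i"] by simp
qed

lemma tracks_blank:
  "tracks m c e h b j i k \<Longrightarrow> valuation_tape e h = Blank \<longleftrightarrow> k = length (decimal (e i))"
  by (auto simp: tracks_def valuation_tape_at)

text \<open>A left move leaves the block undetermined until the next cell is read, so the invariant
  is restored only after \<open>resolve\<close>.\<close>

lemma tracks_step:
  assumes t: "tracks m c e h b j i k" and m: "0 < m" and c: "0 < c"
    and mv: "move_val m (length (decimal c)) b j (valuation_tape e h) d = (b', a', d')"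
  obtains b'' j' i' k' where
    "resolve m (length (decimal c)) b' a' (valuation_tape e (shift d' h)) = (b'', j')"
    "tracks m c e (shift d' h) b'' j' i' k'"
    "padded_head m c e i' k' j' = shift d (padded_head m c e i k j)"
proof (cases d)
  case Stay
  then show ?thesis
    using mv t by (intro that[of b j i k]) (auto simp: resolve_def tracks_def)
next
  case Right
  consider (inside) "valuation_tape e h = Blank" "Suc b mod m = 0" "j < length (decimal c)"
    | (past) "valuation_tape e h = Blank" "\<not> (Suc b mod m = 0 \<and> j < length (decimal c))"
    | (digit) "valuation_tape e h \<noteq> Blank"
    by metis
  then show ?thesis
  proof cases
    case inside
    then show ?thesis
      using mv t Right tracks_blank[OF t]
      by (intro that[of b "Suc j" i k])
        (auto simp: resolve_def tracks_def padded_head_def mod_Suc_eq)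
  next
    case past
    have k: "k = length (decimal (e i))"
      using past tracks_blank[OF t] by simp
    \<comment> \<open>Either the next block is unpadded and \<open>j = 0\<close>, or all inserted
      digits have been crossed.\<close>
    have "pad_length m c (Suc i) = j"
      using past t by (auto simp: pad_length_def tracks_def mod_Suc_eq)
    then show ?thesis
      using mv t Right past k c
      by (intro that[of "Suc i mod m" 0 "Suc i" 0])
        (auto simp: resolve_def tracks_def padded_head_def mod_Suc_eq length_decimal_pad)
  next
    case digit
    then have "k < length (decimal (e i))" "j = 0"
      using tracks_blank[OF t] t by (auto simp: tracks_def)
    then show ?thesis
      using mv t Right digit
      by (intro that[of b 0 i "Suc k"])
        (auto simp: resolve_def tracks_def padded_head_def)
  qed
next
  case Left
  show ?thesis
  proof (cases "0 < j")
    case True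
    then show ?thesis
      using mv t Left
      by (intro that[of b "j - 1" i k]) (auto simp: resolve_def tracks_def padded_head_def)
  next
    case False
    then have [simp]: "j = 0" and mv': "b' = b" "a' = Suc (length (decimal c))" "d' = Left"
      using mv Left by auto
    consider (inside) "0 < k" | (first) "k = 0" "i = 0" | (prev) i0 where "k = 0" "i = Suc i0"
      by (cases i) auto
    then show ?thesis
    proof cases
      case inside
      then have t': "tracks m c e (h - 1) b 0 i (k - 1)"
        using t by (auto simp: tracks_def)
      then have "valuation_tape e (h - 1) \<noteq> Blank"
        using tracks_blank[OF t'] t inside by (auto simp: tracks_def)
      then show ?thesis
        using mv' t' inside Left
        by (intro that[of b 0 i "k - 1"]) (auto simp: resolve_def padded_head_def)
    next
      case first
      \<comment> \<open>At the left end both heads stay put; the cell read again is a digit, so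
        \<open>resolve\<close> does not mistake it for the blank of a previous block.\<close>
      have "valuation_tape e h \<noteq> Blank"
        using tracks_blank[OF t] first decimal_nonempty by simp
      then show ?thesis
        using mv' t first Left
        by (intro that[of b 0 i k])
          (auto simp: resolve_def padded_head_def tracks_def pad_length_def)
    next
      case prev
      \<comment> \<open>The simulated head enters the inserted digits, if there are any, at the last
        one.\<close>
      define j' where "j' = pad_length m c i"
      have b: "b = Suc i0 mod m" and h: "h = val_start e i0 + Suc (length (decimal (e i0)))"
        using t prev by (auto simp: tracks_def)
      have i0: "i0 mod m = (if b = 0 then m - 1 else b - 1)"
        using m unfolding b by (auto simp: mod_Suc)
      have t': "tracks m c e (h - 1) (i0 mod m) j' i0 (length (decimal (e i0)))"
        using h prev by (auto simp: tracks_def j'_def pad_length_def)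
      then have blank: "valuation_tape e (h - 1) = Blank"
        using tracks_blank by blast
      \<comment> \<open>Since \<open>i = Suc i0\<close> is positive, \<open>b = 0\<close> means that
        block \<open>i\<close> is padded; the residue alone tells which case applies.\<close>
      have "resolve m (length (decimal c)) b' a' (valuation_tape e (h - 1)) = (i0 mod m, j')"
        using mv' blank i0 b prev by (auto simp: resolve_def j'_def pad_length_def)
      then show ?thesis
        using mv' t' prev Left c
        by (intro that[of "i0 mod m" j' i0 "length (decimal (e i0))"])
          (auto simp: padded_head_def j'_def length_decimal_pad)
    qed
  qed
qed

text \<open>\<open>C\<close> belongs to the padded machine on \<open>e\<close>, and \<open>D\<close>
  to the simulated one on the padded valuation. The state stores \<open>b\<close> and
  \<open>a\<close>; \<open>b'\<close> and \<open>j\<close> are their corrected values.\<close>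

definition simulates :: "nat \<Rightarrow> nat \<Rightarrow> valuation \<Rightarrow> config \<Rightarrow> config \<Rightarrow> bool" where
  "simulates m c e C D \<longleftrightarrow>
     (\<exists>b a b' j i k.
        state C = prod_encode (state D, prod_encode (b, a)) \<and> b < m \<and>
        a \<le> Suc (length (decimal c)) \<and>
        resolve m (length (decimal c)) b a (valuation_tape e (val_head C)) = (b', j) \<and>
        tracks m c e (val_head C) b' j i k \<and> val_head D = padded_head m c e i k j) \<and>
     work C = work D \<and> work_head C = work_head D \<and> run_head C = run_head D \<and>
     position C = position D"

lemma simulates_step:
  assumes "simulates m c e C D" and m: "0 < m" and c: "0 < c"
  shows "simulates m c e (machine_step (padded M m c) e C) (machine_step M (pad m c e) D)"
proof -
  obtain b a b' j i k where s: "state C = prod_encode (state D, prod_encode (b, a))" "b < m"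
      "a \<le> Suc (length (decimal c))"
    and res: "resolve m (length (decimal c)) b a (valuation_tape e (val_head C)) = (b', j)"
    and t: "tracks m c e (val_head C) b' j i k"
    and vh: "val_head D = padded_head m c e i k j"
    and eqs: "work C = work D" "work_head C = work_head D" "run_head C = run_head D"
      "position C = position D"
    using assms(1) unfolding simulates_def by blast
  obtain q w d1 d2 d3 where tr: "trans M (state D) (work D (work_head D))
      (valuation_tape (pad m c e) (val_head D)) (run_tape (position D) (run_head D)) =
      (q, w, d1, d2, d3)"
    using prod_cases5 by blast
  obtain b2 a2 d2' where
    mv: "move_val m (length (decimal c)) b' j (valuation_tape e (val_head C)) d2 = (b2, a2, d2')"
    using prod_cases3 by blast
  have bounds: "b2 < m" "a2 \<le> Suc (length (decimal c))"
    using resolve_bounds[OF res s(2)] move_val_bounds[OF mv] by auto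
  obtain b3 j' i' k' where new:
    "resolve m (length (decimal c)) b2 a2 (valuation_tape e (shift d2' (val_head C))) = (b3, j')"
    "tracks m c e (shift d2' (val_head C)) b3 j' i' k'"
    "padded_head m c e i' k' j' = shift d2 (padded_head m c e i k j)"
    using tracks_step[OF t m c mv] by blast
  have tr': "trans (padded M m c) (state C) (work C (work_head C))
      (valuation_tape e (val_head C)) (run_tape (position C) (run_head C)) =
      (prod_encode (q, prod_encode (b2, a2)), w, d1, d2', d3)"
    using tr tracks_tape[OF t c]
    by (simp add: padded_def padded_trans_def s(1) res mv eqs vh)
  have C': "machine_step (padded M m c) e C =
    \<lparr>state = prod_encode (q, prod_encode (b2, a2)), work = (work D)(work_head D := w),
     work_head = shift d1 (work_head D), val_head = shift d2' (val_head C),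
     run_head = shift d3 (run_head D), position = position D @
       (if state D \<in> move_states M then [(Machine, written_move (work D))] else [])\<rparr>"
    using tr' by (simp add: machine_step_def s(1) move_states_padded[OF s(2,3)] eqs)
  have D': "machine_step M (pad m c e) D =
    \<lparr>state = q, work = (work D)(work_head D := w),
     work_head = shift d1 (work_head D), val_head = shift d2 (val_head D),
     run_head = shift d3 (run_head D), position = position D @
       (if state D \<in> move_states M then [(Machine, written_move (work D))] else [])\<rparr>"
    by (simp add: machine_step_def tr)
  show ?thesis
    unfolding simulates_def C' D' config.simps using bounds new vh by metis
qed

lemma generated_run_cong: "(\<And>i. position (B i) = position (B' i)) \<Longrightarrow> generated_run B = generated_run B'"
  by (simp add: generated_run_def)

lemma padded_computation:
  assumes B: "computation (padded M m c) e B" and m: "0 < m" and c: "0 < c"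
  obtains B' where "computation M (pad m c e) B'" "generated_run B' = generated_run B"
proof -
  \<comment> \<open>\<open>M\<close> runs on the padded valuation, with each position copied from
    \<open>B\<close>, so the environment makes the same moves at the same steps.\<close>
  define B' where "B' = rec_nat (init_config M)
    (\<lambda>n D. (machine_step M (pad m c e) D)\<lparr>position := position (B (Suc n))\<rparr>)"
  have B'_simps: "B' 0 = init_config M"
    "B' (Suc n) = (machine_step M (pad m c e) (B' n))\<lparr>position := position (B (Suc n))\<rparr>" for n
    by (simp_all add: B'_def)
  have suc: "\<exists>\<beta>s. B (Suc n) = (machine_step (padded M m c) e (B n))
      \<lparr>position := position (machine_step (padded M m c) e (B n)) @ map (Pair Environment) \<beta>s\<rparr>" for n
    using B by (simp add: computation_def successor_def)
  have sim: "simulates m c e (B n) (B' n)" for n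
  proof (induction n)
    case 0
    have "tracks m c e 0 0 0 0 0" "padded_head m c e 0 0 0 = 0"
      by (auto simp: tracks_def padded_head_def pad_length_def)
    moreover have "B 0 = init_config (padded M m c)"
      using B by (simp add: computation_def)
    ultimately show ?case
      using m unfolding simulates_def B'_simps
      by (auto simp: init_config_def padded_def Let_def resolve_def
          intro!: exI[of _ "0::nat"])
  next
    case (Suc n)
    from simulates_step[OF Suc m c, of M] suc[of n] show ?case
      by (auto simp: B'_simps simulates_def) blast
  qed
  have "successor M (pad m c e) (B' n) (B' (Suc n))" for n
  proof -
    have "position (machine_step (padded M m c) e (B n)) =
        position (machine_step M (pad m c e) (B' n))"
      using simulates_step[OF sim m c, of M n] by (simp add: simulates_def)
    then show ?thesis
      using suc[of n] by (auto simp: successor_def B'_simps)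
  qed
  then have "computation M (pad m c e) B'"
    by (simp add: computation_def B'_simps)
  moreover have "generated_run B' = generated_run B"
    using sim by (intro generated_run_cong) (simp add: simulates_def)
  ultimately show thesis by (rule that)
qed

section \<open>Validity and uniform validity\<close>

lemma subst_val_fresh: "y \<notin> set xs \<Longrightarrow> subst_val e xs ts y = e y"
  by (auto simp: subst_val_def split: option.splits dest!: map_of_SomeD set_zip_leftD)

lemma map_subst_val:
  "distinct xs \<Longrightarrow> length xs = length ts \<Longrightarrow> map (subst_val e xs ts) xs = map (tm_val e) ts"
  by (auto simp: subst_val_def map_of_zip_nth intro!: nth_equalityI)

text \<open>Attached variables get their values from the arguments alone, so the base valuation can
  be exchanged.\<close>

lemma subst_val_eq:
  assumes "\<forall>t\<in>set ts. tm_val e t = tm_val e' t" "y \<in> set xs" "length xs = length ts"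
  shows "subst_val e xs ts y = subst_val e\<^sub>0 xs (map (Const \<circ> tm_val e') ts) y"
proof -
  have "map_of (zip xs (map (Const \<circ> tm_val e') ts)) y =
      map_option (Const \<circ> tm_val e') (map_of (zip xs ts) y)"
    by (simp add: zip_map2 map_of_map comp_def)
  moreover obtain t where "map_of (zip xs ts) y = Some t" "t \<in> set ts"
    using assms(2,3) by (metis map_of_SomeD map_of_zip_is_Some set_zip_rightD)
  ultimately show ?thesis
    using assms(1) by (simp add: subst_val_def)
qed

text \<open>\<open>e\<close> is the padded valuation read by \<open>M\<close>, and \<open>e'\<close>
  the original one. As \<open>I\<close> may depend on padded variables outside \<open>F\<close>, the
  loss is recorded at \<open>e'\<close>.\<close>

lemma loses_with_large_fresh_value:
  assumes "\<not> uniformly_valid F" "is_hpm M" "fm_vars F \<subseteq> {..<z}" "0 < z"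
  obtains e e' I B where "n < e z" "is_interp I" "admissible F I" "computation M e B"
    "Wn (fm_game I F) e' (generated_run B) \<noteq> Machine" "\<forall>x\<in>fm_vars F. e x = e' x"
proof -
  have "is_hpm (padded M z (Suc n))"
    using assms by (intro is_hpm_padded)
  then obtain I e' B where I: "is_interp I" "admissible F I"
    and B: "computation (padded M z (Suc n)) e' B"
    and lost: "Wn (fm_game I F) e' (generated_run B) \<noteq> Machine"
    using assms(1) unfolding uniformly_valid_def wins_def by blast
  obtain B' where B': "computation M (pad z (Suc n) e') B'" "generated_run B' = generated_run B"
    using padded_computation[OF B assms(4)] by blast
  have "Suc n * 1 \<le> Suc n * 10 ^ length (decimal (e' z))"
    by (intro mult_le_mono2) simp
  then have "n < pad z (Suc n) e' z"
    using assms(4) unfolding pad_def prepend_def by simp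
  moreover have "\<forall>x\<in>fm_vars F. pad z (Suc n) e' x = e' x"
    using assms(3) by (auto simp: pad_def dest!: dvd_imp_le)
  ultimately show thesis
    using that I B' lost by metis
qed

text \<open>Passing from \<open>e\<^sub>0\<close> to \<open>e'\<close> changes only variables of
  \<open>F\<close>. The attached ones are overwritten by the arguments, and by admissibility
  \<open>B\<close> does not depend on the others.\<close>

lemma agree_atom:
  assumes "is_interp J" "admissible F J" "is_interp I"
    and I: "I p (length ts) = (A, ys)" and J: "J p (length ts) = (B, xs)"
    and A: "Wn A (subst_val e ys ts) (Fin []) =
      Wn B (subst_val e\<^sub>0 xs (map (Const \<circ> tm_val e) ts)) (Fin [])"
    and vars: "{x. Var x \<in> set ts} \<subseteq> fm_vars F"
    and ee': "\<forall>x\<in>fm_vars F. e x = e' x" and e': "\<forall>x. x \<notin> fm_vars F \<longrightarrow> e' x = e\<^sub>0 x"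
  shows "agree (fm_game I (Atom p ts)) e (fm_game J (Atom p ts)) e'"
proof -
  have elem: "elementary A" "elementary B" and len: "length xs = length ts"
    using assms(1,3) I J by (auto simp: is_interp_def)
  have tm: "\<forall>t\<in>set ts. tm_val e' t = tm_val e t"
  proof
    fix t assume "t \<in> set ts"
    show "tm_val e' t = tm_val e t"
      by (cases t) (use \<open>t \<in> set ts\<close> vars ee' in auto)
  qed
  let ?e1 = "subst_val e\<^sub>0 xs (map (Const \<circ> tm_val e) ts)" and ?e2 = "subst_val e' xs ts"
  have "agree B ?e1 B ?e2"
  proof (rule agree_if_not_depends_on)
    show "finite (fm_vars F - set xs)"
      by (simp add: finite_fm_vars)
    show "\<forall>x\<in>fm_vars F - set xs. \<not> depends_on B x"
      using assms(2) J by (auto simp: admissible_def)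
    show "\<forall>x. x \<notin> fm_vars F - set xs \<longrightarrow> ?e1 x = ?e2 x"
    proof (intro allI impI)
      fix x assume "x \<notin> fm_vars F - set xs"
      then show "?e1 x = ?e2 x"
        using subst_val_eq[OF tm _ len, of x e\<^sub>0] e'
        by (cases "x \<in> set xs") (auto simp: subst_val_fresh)
    qed
  qed
  then have "Wn A (subst_val e ys ts) (Fin []) = Wn B ?e2 (Fin [])"
    using A by (simp add: agree_def)
  then have "agree A (subst_val e ys ts) B ?e2"
    using elem by (rule agree_elementary[rotated 2])
  then show ?thesis
    by (simp add: I J agree_def g_subst_def)
qed

section \<open>The diagonal interpretation\<close>

theorem theorem5p11:
  fixes F :: fm
  shows "valid F \<longleftrightarrow> uniformly_valid F"
proof
  assume "uniformly_valid F"
  then show "valid F"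
    unfolding valid_def uniformly_valid_def computable_def by blast
next
  assume valid: "valid F"
  show "uniformly_valid F"
  proof (rule ccontr)
    assume nu: "\<not> uniformly_valid F"
    obtain z where z: "fm_vars F \<subseteq> {..<z}" "0 < z"
      using finite_fm_vars[of F] unfolding finite_nat_set_iff_bounded
      by (metis lessThan_iff not_gr_zero not_less_zero subsetI zero_less_one less_trans)
    have z_fresh: "z \<notin> fm_vars F"
      using z by auto
    obtain M\<^sub>0 where M0: "is_hpm M\<^sub>0"
    proof
      show "is_hpm \<lparr>states = {0}, start = 0, move_states = {}, work_alphabet = {Blank},
        trans = \<lambda>_ _ _ _. (0, Blank, Stay, Stay, Stay)\<rparr>"
        by (simp add: is_hpm_def)
    qed
    obtain Ms :: "nat \<Rightarrow> hpm" where Ms: "\<And>n. is_hpm (Ms n)"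
      "\<And>M. is_hpm M \<Longrightarrow> \<exists>n. \<forall>e B. computation (Ms n) e B \<longrightarrow> computation M e B"
      using enumerate_hpms[OF M0] by metis
    define bad where "bad n e e' I B \<longleftrightarrow> is_interp I \<and> admissible F I \<and> computation (Ms n) e B \<and>
      Wn (fm_game I F) e' (generated_run B) \<noteq> Machine \<and> (\<forall>x\<in>fm_vars F. e x = e' x)"
      for n e e' I B
    have ex_bad: "\<exists>d>k. \<exists>e e' I B. e z = d \<and> bad n e e' I B" for n k
    proof -
      obtain e e' I B where "k < e z" "is_interp I" "admissible F I" "computation (Ms n) e B"
        "Wn (fm_game I F) e' (generated_run B) \<noteq> Machine" "\<forall>x\<in>fm_vars F. e x = e' x"
        by (rule loses_with_large_fresh_value[OF nu Ms(1) z])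
      then show ?thesis unfolding bad_def by blast
    qed
    \<comment> \<open>Strictly increasing values are distinct, so \<open>inv d\<close> recovers
      \<open>n\<close> from the value \<open>d n\<close> of \<open>z\<close>.\<close>
    have "\<exists>d. \<forall>n. (\<exists>e e' I B. e z = d n \<and> bad n e e' I B) \<and> d n < d (Suc n)"
      by (rule dependent_nat_choice) (use ex_bad in blast)+
    then obtain d where d: "\<And>n. \<exists>e e' I B. e z = d n \<and> bad n e e' I B" "\<And>n. d n < d (Suc n)"
      by blast
    have "inj d"
      using d(2) by (intro strict_mono_imp_inj_on) (simp add: strict_mono_Suc_iff)
    obtain e e' J B where eJB: "\<And>n. e n z = d n" "\<And>n. bad n (e n) (e' n) (J n) (B n)"
      using d(1) by metis
    \<comment> \<open>The base valuation \<open>e' n\<close> settles how \<open>J n\<close> depends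
      on variables outside \<open>F\<close>.\<close>
    define truth where "truth n p cs = (case J n p (length cs) of (A, xs) \<Rightarrow>
      Wn A (subst_val (e' n) xs (map Const cs)) (Fin []))" for n p cs
    \<comment> \<open>Each value \<open>d n\<close> of the fresh variable \<open>z\<close> selects the interpretation that defeats \<open>Ms n\<close>.\<close>
    define I :: interp where "I p k =
      (mk_game (\<lambda>_. {Fin []}) (\<lambda>e _. truth (inv d (e z)) p (map e [Suc z..<Suc z + k])),
       [Suc z..<Suc z + k])" for p k
    have I_interp: "is_interp I"
      by (auto simp: is_interp_def I_def elementary_mk_game)
    have "admissible F I"
      unfolding admissible_def
    proof (intro allI impI ballI)
      fix p k A xs x
      assume A: "I p k = (A, xs)" and x: "x \<in> fm_vars F - set xs"
      \<comment> \<open>The predicate reads only \<open>z\<close> and the attached variables above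
        it, hence not \<open>x\<close>.\<close>
      have "x < z"
        using x z by auto
      have "Lr A f = Lr A f' \<and> Wn A f = Wn A f'" if "\<forall>y. y \<noteq> x \<longrightarrow> f y = f' y" for f f'
      proof -
        have "map f [Suc z..<Suc z + k] = map f' [Suc z..<Suc z + k]" "f z = f' z"
          using that \<open>x < z\<close> by auto
        then have "agree A f A f'"
          using A unfolding I_def prod.inject by (auto intro!: agree_mk_game simp del: upt_Suc map_eq_conv)
        then show ?thesis
          by (simp add: agree_def)
      qed
      then show "\<not> depends_on A x"
        unfolding depends_on_def by blast
    qed
    then obtain M where M: "is_hpm M" "wins M (fm_game I F)"
      using valid I_interp unfolding valid_def computable_def by blast
    \<comment> \<open>The play that beats \<open>Ms n\<close> under \<open>J n\<close> is also a
      play of \<open>M\<close>.\<close>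
    then obtain n where n: "\<And>e B. computation (Ms n) e B \<Longrightarrow> computation M e B"
      using Ms(2) by blast
    \<comment> \<open>Quantifiers of \<open>F\<close> update only variables of \<open>F\<close>; all
      others, \<open>z\<close> among them, keep the values given by \<open>e n\<close> and
      \<open>e' n\<close>.\<close>
    define R where "R f f' \<longleftrightarrow> (\<forall>x\<in>fm_vars F. f x = f' x) \<and>
      (\<forall>x. x \<notin> fm_vars F \<longrightarrow> f x = e n x \<and> f' x = e' n x)" for f f'
    have J: "is_interp (J n)" "admissible F (J n)"
      using eJB(2)[of n] by (auto simp: bad_def)
    have "agree (fm_game I F) (e n) (fm_game (J n) F) (e' n)"
    proof (rule fm_game_cong[where R = R and V = "fm_vars F"])
      show "R (e n) (e' n)"
        using eJB(2)[of n] by (simp add: R_def bad_def)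
      show "R (f(x := c)) (f'(x := c))" if "R f f'" "x \<in> fm_vars F" for f f' x c
        using that by (auto simp: R_def)
      show "agree (fm_game I (Atom p ts)) f (fm_game (J n) (Atom p ts)) f'"
        if R: "R f f'" and ts: "{x. Var x \<in> set ts} \<subseteq> fm_vars F" for f f' p ts
      proof -
        let ?ys = "[Suc z..<Suc z + length ts]"
        obtain A where A: "I p (length ts) = (A, ?ys)" "\<And>f. Wn A f (Fin []) =
            truth (inv d (f z)) p (map f ?ys)"
          by (simp add: I_def mk_game_def)
        obtain A' xs where A': "J n p (length ts) = (A', xs)"
          by fastforce
        \<comment> \<open>The attached variables start at \<open>Suc z\<close>, so substituting the
          arguments does not disturb the selector \<open>z\<close>.\<close>
        have "subst_val f ?ys ts z = d n"
          using R z_fresh eJB(1)[of n] by (subst subst_val_fresh) (auto simp: R_def)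
        then have "Wn A (subst_val f ?ys ts) (Fin []) = truth n p (map (tm_val f) ts)"
          using \<open>inj d\<close> map_subst_val[of ?ys ts f] by (simp add: A(2) del: upt_Suc)
        then have "Wn A (subst_val f ?ys ts) (Fin []) =
            Wn A' (subst_val (e' n) xs (map (Const \<circ> tm_val f) ts)) (Fin [])"
          by (simp add: truth_def A')
        then show ?thesis
          using R by (intro agree_atom[OF J I_interp A(1) A' _ ts]) (auto simp: R_def)
      qed
    qed simp
    then have "Wn (fm_game I F) (e n) (generated_run (B n)) \<noteq> Machine"
      using eJB(2)[of n] by (simp add: agree_def bad_def)
    moreover have "computation M (e n) (B n)"
      using eJB(2)[of n] n by (simp add: bad_def)
    ultimately show False
      using M(2) by (simp add: wins_def)
  qed
qed

end
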